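(* Let $n\ge 2$. Let $H\in C^0(\mathbb R^n)$ be convex and superlinear, with $H(0)=\min_{\mathbb R^n}H=0$, and suppose that for every $c\in\mathbb R$ the level set $H^{-1}(c)$ does not contain any line segment. Let $0\le k<\infty$ and suppose that $u\in C^{0,1}(\mathbb R^n)$ satisfies $$S^+_tu(0)=-S^-_tu(0)=k\quad\text{for all } t>0,\qquad \max\{S^+_tu(x),\,-S^-_tu(x)\}\le k\quad\text{for all }x\in\mathbb R^n,\ t>0.$$ Then there exists a vector $p_0\in\mathbb R^n$ such that $H(p_0)=k$ and $u(x)=u(0)+p_0\cdot x$ for all $x\in\mathbb R^n$.
   Context: Superlinear means $\lim_{|p|\to\infty}H(p)/|p|=\infty$. A line segment is a set $[a,b]$ with $a\neq b$. $C^{0,1}(\mathbb R^n)$ is the space of Lipschitz functions on $\mathbb R^n$. $L(q)=\sup_{p\in\mathbb R^n}(p\cdot q-H(p))$ is the convex conjugate of $H$. For $t>0$ and $x\in\mathbb R^n$, $$T^tu(x)=\sup_{y\in\mathbb R^n}\Big\{u(y)-tL\big(\tfrac{y-x}{t}\big)\Big\},\qquad T_tu(x)=\inf_{y\in\mathbb R^n}\Big\{u(y)+tL\big(\tfrac{x-y}{t}\big)\Big\},$$ $$S^+_tu(x)=\tfrac1t\big(T^tu(x)-u(x)\big),\qquad S^-_tu(x)=\tfrac1t\big(T_tu(x)-u(x)\big).$$ *)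

theory Defs
  imports "HOL-Analysis.Analysis"
begin

definition superlinear :: "('a::real_normed_vector \<Rightarrow> real) \<Rightarrow> bool" where
  "superlinear H \<longleftrightarrow> filterlim (\<lambda>p. H p / norm p) at_top at_infinity"

definition line_segment :: "'a::real_vector set \<Rightarrow> bool" where
  "line_segment S \<longleftrightarrow> (\<exists>a b. a \<noteq> b \<and> S = closed_segment a b)"

text \<open>
  The suprema and infima below are taken in the reals. This is harmless for the intended arguments:
  if \<open>H\<close> is continuous and superlinear on a Euclidean space, then \<open>p \<bullet> q - H p\<close> is bounded above
  in \<open>p\<close>, so the conjugate is finite. As \<open>H\<close> is finite-valued and continuous, the conjugate is
  itself superlinear and bounded below, so for Lipschitz \<open>u\<close> and \<open>t > 0\<close> the sets in \<open>T_up\<close> and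
  \<open>T_down\<close> are bounded above and below, respectively.
\<close>

definition convex_conjugate :: "('a::real_inner \<Rightarrow> real) \<Rightarrow> 'a \<Rightarrow> real" where
  "convex_conjugate H q = (SUP p. p \<bullet> q - H p)"

text \<open>\<open>T_up H t u\<close> is $T^t u$ and \<open>T_down H t u\<close> is $T_t u$.\<close>

definition T_up :: "('a::real_inner \<Rightarrow> real) \<Rightarrow> real \<Rightarrow> ('a \<Rightarrow> real) \<Rightarrow> 'a \<Rightarrow> real" where
  "T_up H t u x = (SUP y. u y - t * convex_conjugate H ((y - x) /\<^sub>R t))"

definition T_down :: "('a::real_inner \<Rightarrow> real) \<Rightarrow> real \<Rightarrow> ('a \<Rightarrow> real) \<Rightarrow> 'a \<Rightarrow> real" where
  "T_down H t u x = (INF y. u y + t * convex_conjugate H ((x - y) /\<^sub>R t))"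

definition S_plus :: "('a::real_inner \<Rightarrow> real) \<Rightarrow> real \<Rightarrow> ('a \<Rightarrow> real) \<Rightarrow> 'a \<Rightarrow> real" where
  "S_plus H t u x = (1 / t) * (T_up H t u x - u x)"

definition S_minus :: "('a::real_inner \<Rightarrow> real) \<Rightarrow> real \<Rightarrow> ('a \<Rightarrow> real) \<Rightarrow> 'a \<Rightarrow> real" where
  "S_minus H t u x = (1 / t) * (T_down H t u x - u x)"

end

theory Submission
  imports Defs
begin

text \<open>
  Let \<open>K\<close> be the sublevel set \<open>{H \<le> k}\<close> and \<open>\<sigma>\<close> its support function, so that \<open>\<sigma> q\<close> is the
  maximum of \<open>p \<bullet> q\<close> over \<open>p\<close> in \<open>K\<close>. The upper bound on the slopes \<open>S_plus\<close> says that
  \<open>u y - u x \<le> t (k + L ((y - x) / t))\<close> for all \<open>x\<close>, \<open>y\<close> and \<open>t > 0\<close>. If \<open>k > 0\<close>, minimizing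
  the right side over \<open>t\<close> gives exactly \<open>\<sigma> (y - x)\<close>: one inequality is Fenchel's
  (\<open>support_le_action\<close>), the other is a Lagrange multiplier argument (\<open>multiplier_time\<close>). So
  \<open>u y - u x \<le> \<sigma> (y - x)\<close> (\<open>dominated_le_support\<close>).

  The equalities at the origin supply, for every time \<open>t\<close>, points \<open>Y\<close> and \<open>-W\<close> with
  \<open>u Y - u 0 \<approx> \<sigma> Y\<close> and \<open>u 0 - u (-W) \<approx> \<sigma> W\<close>, up to an error that may be chosen as small as
  desired. Passing from \<open>-W\<close> to \<open>Y\<close> through the origin then gives \<open>\<sigma> Y + \<sigma> W \<approx> \<sigma> (Y + W)\<close>,
  hence a point of \<open>K\<close> that maximizes \<open>p \<bullet> (Y + W)\<close> almost maximizes \<open>p \<bullet> Y\<close> and \<open>p \<bullet> W\<close> as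
  well (\<open>common_maximizer\<close>). Let \<open>t\<close> tend to infinity. The Lipschitz bound keeps \<open>Y / t\<close> and
  \<open>W / t\<close> bounded, and \<open>k > 0\<close> keeps them away from \<open>0\<close>, so along a subsequence they converge to
  nonzero directions \<open>q\<close> and \<open>w\<close> that share a maximizer \<open>p\<close>. A level set without segments makes
  the maximizer in a nonzero direction unique (\<open>maximizer_unique\<close>), that is, \<open>\<sigma>\<close> is differentiable
  there with gradient \<open>p\<close>. Seen from the far point \<open>Y\<close>, the comparison reads
  \<open>u x - u 0 \<ge> \<sigma> Y - \<sigma> (Y - x) - o(1)\<close>, and the right side tends to \<open>p \<bullet> x\<close>
  (\<open>optimal_slope_le\<close>). Seen from \<open>-W\<close> it gives the reverse inequality with the same \<open>p\<close>, so \<open>u\<close>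
  is affine with slope \<open>p\<close>; and \<open>p\<close> lies on the boundary of \<open>K\<close>, where \<open>H\<close> equals \<open>k\<close>.

  If \<open>k = 0\<close>, then \<open>K\<close> is the convex zero set of \<open>H\<close> and has no segment, so it is \<open>{0}\<close>.
  Comparison at the levels \<open>c > 0\<close> with \<open>c\<close> tending to \<open>0\<close> shows that \<open>u\<close> is constant
  (\<open>dominated_zero_const\<close>).
\<close>

section \<open>Superlinear convex Hamiltonians and their conjugates\<close>

locale convex_hamiltonian =
  fixes H :: "'a::euclidean_space \<Rightarrow> real"
  assumes cont: "continuous_on UNIV H"
    and conv: "convex_on UNIV H"
    and superlin: "superlinear H"
    and H_zero: "H 0 = 0"
    and H_nonneg: "0 \<le> H p"
begin

abbreviation L :: "'a \<Rightarrow> real" where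
  "L \<equiv> convex_conjugate H"

lemma superlinear_growth:
  obtains R where "\<And>p. R \<le> norm p \<Longrightarrow> a * norm p \<le> H p" "0 < R"
proof -
  have "eventually (\<lambda>p. a \<le> H p / norm p) at_infinity"
    using superlin unfolding superlinear_def filterlim_at_top by blast
  then obtain b where b: "\<And>p. b \<le> norm p \<Longrightarrow> a \<le> H p / norm p"
    unfolding eventually_at_infinity by blast
  show ?thesis
  proof (rule that[of "max b 1"])
    fix p :: 'a
    assume "max b 1 \<le> norm p"
    then have "0 < norm p" and "a \<le> H p / norm p"
      using b by auto
    then show "a * norm p \<le> H p"
      by (simp add: pos_le_divide_eq)
  qed auto
qed

lemma conjugate_bdd: "bdd_above (range (\<lambda>p. p \<bullet> q - H p))"
proof -
  obtain R where R: "\<And>p. R \<le> norm p \<Longrightarrow> norm q * norm p \<le> H p" and "0 < R"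
    using superlinear_growth[of "norm q"] by blast
  have "p \<bullet> q - H p \<le> norm q * R" for p
  proof (cases "R \<le> norm p")
    case True
    have "p \<bullet> q \<le> norm q * norm p"
      by (metis mult.commute norm_cauchy_schwarz)
    moreover have "0 \<le> norm q * R"
      using \<open>0 < R\<close> by simp
    ultimately show ?thesis
      using R[OF True] by linarith
  next
    case False
    have "p \<bullet> q \<le> norm q * norm p"
      by (metis mult.commute norm_cauchy_schwarz)
    also have "\<dots> \<le> norm q * R"
      using False by (intro mult_left_mono) auto
    finally show ?thesis
      using H_nonneg[of p] by linarith
  qed
  then show ?thesis
    by (auto simp: bdd_above_def)
qed

lemma Fenchel_inequality: "p \<bullet> q \<le> H p + L q"
proof -
  have "p \<bullet> q - H p \<le> L q"
    unfolding convex_conjugate_def by (rule cSUP_upper[OF UNIV_I conjugate_bdd])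
  then show ?thesis
    by linarith
qed

lemma conjugate_least: "(\<And>p. p \<bullet> q - H p \<le> b) \<Longrightarrow> L q \<le> b"
  unfolding convex_conjugate_def by (rule cSUP_least) auto

lemma conjugate_nonneg: "0 \<le> L q"
  using Fenchel_inequality[of 0 q] H_zero by simp

text \<open>
  Testing the supremum defining \<open>L q\<close> with the vector of length \<open>a\<close> in the direction of \<open>q\<close> costs
  only the values of \<open>H\<close> on a ball. This makes \<open>L\<close> superlinear.
\<close>

lemma conjugate_growth:
  assumes "0 \<le> a"
  obtains M where "\<And>q. a * norm q - M \<le> L q"
proof -
  have "compact (H ` cball 0 a)"
    by (intro compact_continuous_image continuous_on_subset[OF cont]) auto
  then have "bdd_above (H ` cball 0 a)"
    by (intro bounded_imp_bdd_above compact_imp_bounded)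
  then obtain M where M: "\<And>p. norm p \<le> a \<Longrightarrow> H p \<le> M"
    by (force simp: bdd_above_def)
  have "a * norm q - M \<le> L q" for q
  proof -
    have "H (a *\<^sub>R sgn q) \<le> M"
      using assms by (intro M) (simp add: norm_sgn)
    moreover have "(a *\<^sub>R sgn q) \<bullet> q = a * norm q"
      by (simp add: sgn_div_norm dot_square_norm power2_eq_square divide_simps)
    ultimately show ?thesis
      using Fenchel_inequality[of "a *\<^sub>R sgn q" q] by linarith
  qed
  then show ?thesis
    using that by blast
qed

section \<open>Maximizers over the sublevel sets\<close>

definition maximizer :: "real \<Rightarrow> 'a \<Rightarrow> 'a \<Rightarrow> bool" where
  "maximizer c q p \<longleftrightarrow> H p \<le> c \<and> (\<forall>r. H r \<le> c \<longrightarrow> r \<bullet> q \<le> p \<bullet> q)"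

lemma compact_sublevel: "compact {p. H p \<le> c}"
proof -
  obtain R where R: "\<And>p. R \<le> norm p \<Longrightarrow> 1 * norm p \<le> H p" and "0 < R"
    using superlinear_growth[of 1] by blast
  have "norm p \<le> max R c" if "H p \<le> c" for p
    using R[of p] that by (cases "R \<le> norm p") auto
  then have "bounded {p. H p \<le> c}"
    by (auto simp: bounded_iff)
  moreover have "closed {p. H p \<le> c}"
    using closed_Collect_le[OF cont, of "\<lambda>_. c"] by auto
  ultimately show ?thesis
    by (simp add: compact_eq_bounded_closed)
qed

lemma sublevel_subsequence:
  assumes "\<And>n::nat. H (p n) \<le> c"
  shows "\<exists>l r. strict_mono r \<and> (p \<circ> r) \<longlonglongrightarrow> l"
proof -
  have "\<forall>n. p n \<in> {p. H p \<le> c}"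
    using assms by simp
  with compact_sublevel[of c] show ?thesis
    unfolding compact_def by blast
qed

lemma maximizer_exists:
  assumes "0 \<le> c"
  obtains p where "maximizer c q p"
proof -
  have "\<exists>p\<in>{p. H p \<le> c}. \<forall>r\<in>{p. H p \<le> c}. r \<bullet> q \<le> p \<bullet> q"
    using assms H_zero
    by (intro continuous_attains_sup compact_sublevel continuous_intros) (auto intro: exI[of _ 0])
  then show ?thesis
    using that by (auto simp: maximizer_def)
qed

lemma maximizer_scale:
  assumes "maximizer c q p" "0 < s"
  shows "maximizer c (s *\<^sub>R q) p"
  using assms by (simp add: maximizer_def)

text \<open>
  Convexity bounds the value at \<open>p + s q\<close> by a convex combination of \<open>H p\<close> and \<open>H (p + q)\<close>, so a
  point strictly inside the sublevel set can still be pushed in the direction \<open>q\<close>.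
\<close>

lemma maximizer_on_level:
  assumes max: "maximizer c q p" and "q \<noteq> 0"
  shows "H p = c"
proof (rule ccontr)
  assume "H p \<noteq> c"
  then have less: "H p < c"
    using max by (simp add: maximizer_def)
  define d where "d = H (p + q) - H p"
  define s where "s = (c - H p) / (\<bar>d\<bar> + (c - H p))"
  have s: "0 < s" "s \<le> 1"
    using less by (auto simp: s_def divide_simps add_nonneg_pos)
  have "s * d \<le> c - H p"
  proof -
    have "s * d \<le> s * (\<bar>d\<bar> + (c - H p))"
      using s less by (intro mult_left_mono) auto
    also have "\<dots> = c - H p"
      using less by (simp add: s_def add_nonneg_pos)
    finally show ?thesis .
  qed
  moreover have "H ((1 - s) *\<^sub>R p + s *\<^sub>R (p + q)) \<le> (1 - s) * H p + s * H (p + q)"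
    using s by (intro convex_onD[OF conv]) auto
  moreover have "(1 - s) *\<^sub>R p + s *\<^sub>R (p + q) = p + s *\<^sub>R q"
    by (simp add: algebra_simps)
  ultimately have "H (p + s *\<^sub>R q) \<le> c"
    by (simp add: d_def algebra_simps)
  then have "(p + s *\<^sub>R q) \<bullet> q \<le> p \<bullet> q"
    using max by (simp add: maximizer_def)
  moreover have "0 < s * (q \<bullet> q)"
    using s \<open>q \<noteq> 0\<close> by simp
  ultimately show False
    by (simp add: inner_add_left)
qed

text \<open>
  The maximizers in a nonzero direction form a convex set contained in the level set, hence a single
  point once the level set contains no segment.
\<close>

lemma maximizer_unique:
  assumes "\<not> (\<exists>S. line_segment S \<and> S \<subseteq> H -` {c})"
    and "q \<noteq> 0" and p: "maximizer c q p" and p': "maximizer c q p'"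
  shows "p = p'"
proof (rule ccontr)
  assume "p \<noteq> p'"
  then have "line_segment (closed_segment p p')"
    unfolding line_segment_def by blast
  moreover have "H r = c" if r: "r \<in> closed_segment p p'" for r
  proof (rule maximizer_on_level[OF _ \<open>q \<noteq> 0\<close>])
    obtain s where s: "0 \<le> s" "s \<le> 1" "r = (1 - s) *\<^sub>R p + s *\<^sub>R p'"
      using r by (auto simp: in_segment)
    have "p \<bullet> q = p' \<bullet> q"
      using p p' by (auto simp: maximizer_def intro: antisym)
    then have rq: "r \<bullet> q = p \<bullet> q"
      by (simp add: s algebra_simps)
    have "H r \<le> (1 - s) * H p + s * H p'"
      unfolding s(3) using s by (intro convex_onD[OF conv]) auto
    also have "\<dots> \<le> c"
      using p p' s by (intro convex_bound_le) (auto simp: maximizer_def)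
    finally show "maximizer c q r"
      using p rq by (simp add: maximizer_def)
  qed
  ultimately show False
    using assms(1) by blast
qed

text \<open>
  Closedness of the graph of the set of maximizers, with an error \<open>e\<close> that leaves room for almost
  maximizers.
\<close>

lemma maximizer_limit:
  assumes p: "p \<longlonglongrightarrow> p0" and q: "q \<longlonglongrightarrow> q0" and e: "e \<longlonglongrightarrow> (0::real)"
    and le: "\<And>n. H (p n) \<le> c"
    and max: "\<And>n r. H r \<le> c \<Longrightarrow> r \<bullet> q n \<le> p n \<bullet> q n + e n"
  shows "maximizer c q0 p0"
  unfolding maximizer_def
proof (intro conjI allI impI)
  have "closed {p. H p \<le> c}"
    using compact_sublevel compact_imp_closed by blast
  then show "H p0 \<le> c"
    using p le closed_sequentially[of "{p. H p \<le> c}"] by auto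
next
  fix r
  assume r: "H r \<le> c"
  have "(\<lambda>n. r \<bullet> q n) \<longlonglongrightarrow> r \<bullet> q0"
    using q by (intro tendsto_intros)
  moreover have "(\<lambda>n. p n \<bullet> q n + e n) \<longlonglongrightarrow> p0 \<bullet> q0 + 0"
    using p q e by (intro tendsto_intros)
  ultimately have "r \<bullet> q0 \<le> p0 \<bullet> q0 + 0"
    using max[OF r] by (intro LIMSEQ_le) auto
  then show "r \<bullet> q0 \<le> p0 \<bullet> q0"
    by simp
qed

section \<open>The support function as an infimum over times\<close>

lemma support_le_action:
  assumes "0 < t" "H p \<le> c"
  shows "p \<bullet> q \<le> t * (c + L (q /\<^sub>R t))"
proof -
  have "p \<bullet> q = t * (p \<bullet> (q /\<^sub>R t))"
    using assms by simp
  also have "\<dots> \<le> t * (c + L (q /\<^sub>R t))"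
    using Fenchel_inequality[of p "q /\<^sub>R t"] assms by (intro mult_left_mono) auto
  finally show ?thesis .
qed

text \<open>
  The time \<open>t\<close> is a Lagrange multiplier for maximizing \<open>r \<bullet> q\<close> under \<open>H r \<le> c\<close>. The slopes
  \<open>(r \<bullet> q - p \<bullet> q) / (H r - c)\<close> over points \<open>r\<close> outside the sublevel set lie below the corresponding
  slopes over points strictly inside, because the convex combination of two such points at level
  \<open>c\<close> competes with \<open>p\<close>; their supremum separates the two families. It is positive since going
  far in the direction \<open>q\<close> gives a positive slope.
\<close>

lemma multiplier_time:
  assumes max: "maximizer c q p" and "0 < c" "q \<noteq> 0"
  obtains t where "0 < t" "t * (c + L (q /\<^sub>R t)) \<le> p \<bullet> q"
proof -
  \<comment> \<open>One formula serves on both sides: inside the sublevel set numerator and denominator change sign.\<close>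
  define sl where "sl r = (r \<bullet> q - p \<bullet> q) / (H r - c)" for r
  define A where "A = {r. c < H r}"
  have cross: "sl r \<le> sl z" if r: "c < H r" and z: "H z < c" for r z
  proof -
    define a b where "a = H r - c" and "b = c - H z"
    have ab: "0 < a" "0 < b"
      using r z by (auto simp: a_def b_def)
    define s where "s = b / (a + b)"
    have s: "0 \<le> s" "s \<le> 1" and s1: "1 - s = a / (a + b)"
      using ab by (auto simp: s_def field_simps)
    have "H ((1 - s) *\<^sub>R z + s *\<^sub>R r) \<le> (1 - s) * H z + s * H r"
      using s by (intro convex_onD[OF conv]) auto
    also have "\<dots> = (a * H z + b * H r) / (a + b)"
      unfolding s1 by (simp add: s_def add_divide_distrib)
    also have "\<dots> = c"
    proof -
      have "a * H z + b * H r = c * (a + b)"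
        by (simp add: a_def b_def algebra_simps)
      then show ?thesis
        using ab by simp
    qed
    finally have "((1 - s) *\<^sub>R z + s *\<^sub>R r) \<bullet> q \<le> p \<bullet> q"
      using max by (simp add: maximizer_def)
    then have "(a * (z \<bullet> q) + b * (r \<bullet> q)) / (a + b) \<le> p \<bullet> q"
      unfolding inner_add_left inner_scaleR_left s1 by (simp add: s_def add_divide_distrib)
    then have "a * (z \<bullet> q) + b * (r \<bullet> q) \<le> (p \<bullet> q) * (a + b)"
      using ab by (simp add: pos_divide_le_eq)
    then have "(r \<bullet> q - p \<bullet> q) * b \<le> (p \<bullet> q - z \<bullet> q) * a"
      by (simp add: algebra_simps)
    then have "(r \<bullet> q - p \<bullet> q) / a \<le> (p \<bullet> q - z \<bullet> q) / b"
      using ab by (simp add: frac_le_eq divide_simps)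
    moreover have "(p \<bullet> q - z \<bullet> q) / b = sl z"
      unfolding sl_def b_def
      by (metis minus_diff_eq minus_divide_divide)
    ultimately show ?thesis
      by (simp add: sl_def a_def)
  qed
  define t where "t = (SUP r\<in>A. sl r)"
  have bdd: "bdd_above (sl ` A)"
    using cross[of _ 0] \<open>0 < c\<close> H_zero unfolding A_def bdd_above_def by auto
  have upper: "sl r \<le> t" if "c < H r" for r
    unfolding t_def using that by (intro cSUP_upper bdd) (auto simp: A_def)
  obtain R where R: "\<And>r. R \<le> norm r \<Longrightarrow> 1 * norm r \<le> H r" and "0 < R"
    using superlinear_growth[of 1] by blast
  \<comment> \<open>A multiple of \<open>q\<close> that is long enough to satisfy \<open>H far > c\<close> and \<open>far \<bullet> q > p \<bullet> q\<close>.\<close>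
  define far where "far = (max R (max (c + 1) (\<bar>p \<bullet> q\<bar> / norm q + 1))) *\<^sub>R sgn q"
  have norm_far: "norm far = max R (max (c + 1) (\<bar>p \<bullet> q\<bar> / norm q + 1))"
    using \<open>0 < R\<close> \<open>q \<noteq> 0\<close> by (simp add: far_def norm_sgn)
  have far_out: "c < H far"
    using R[of far] norm_far by linarith
  have "p \<bullet> q < far \<bullet> q"
  proof -
    have "p \<bullet> q < (\<bar>p \<bullet> q\<bar> / norm q + 1) * norm q"
      using \<open>q \<noteq> 0\<close> by (simp add: distrib_right add_strict_increasing2)
        (smt (verit) zero_less_norm_iff)
    also have "\<dots> \<le> norm far * norm q"
      unfolding norm_far by (intro mult_right_mono) auto
    also have "\<dots> = far \<bullet> q"
      unfolding norm_far using \<open>q \<noteq> 0\<close>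
      by (simp add: far_def sgn_div_norm dot_square_norm power2_eq_square)
    finally show ?thesis .
  qed
  then have "0 < sl far"
    using far_out by (simp add: sl_def)
  then have "0 < t"
    using upper[OF far_out] by linarith
  have lower: "t \<le> sl z" if "H z < c" for z
    unfolding t_def using cross[OF _ that] far_out by (intro cSUP_least) (auto simp: A_def)
  have supp: "r \<bullet> q - p \<bullet> q \<le> t * (H r - c)" for r
  proof (rule linorder_cases[of "H r" c])
    assume "H r < c"
    then show ?thesis
      using lower[of r] by (simp add: sl_def neg_le_divide_eq)
  next
    assume "H r = c"
    then show ?thesis
      using max by (simp add: maximizer_def)
  next
    assume "c < H r"
    then show ?thesis
      using upper[of r] by (simp add: sl_def pos_divide_le_eq)
  qed
  have "L (q /\<^sub>R t) \<le> (p \<bullet> q) / t - c"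
  proof (rule conjugate_least)
    fix r
    have "(r \<bullet> q) / t \<le> (p \<bullet> q) / t + (H r - c)"
      using supp[of r] \<open>0 < t\<close> by (simp add: field_simps)
    then show "r \<bullet> (q /\<^sub>R t) - H r \<le> (p \<bullet> q) / t - c"
      by (simp add: divide_inverse mult.commute)
  qed
  then have "t * (c + L (q /\<^sub>R t)) \<le> p \<bullet> q"
    using \<open>0 < t\<close> by (simp add: field_simps)
  then show ?thesis
    using that \<open>0 < t\<close> by blast
qed

section \<open>Functions dominated at energy \<open>c\<close>\<close>

text \<open>
  In weak KAM theory this relation is written \<open>v \<prec> L + c\<close>; it says that neither Lax--Oleinik
  evolution moves \<open>v\<close> with speed greater than \<open>c\<close>.
\<close>

definition dominated :: "real \<Rightarrow> ('a \<Rightarrow> real) \<Rightarrow> bool" where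
  "dominated c v \<longleftrightarrow> (\<forall>x y t. 0 < t \<longrightarrow> v y - v x \<le> t * (c + L ((y - x) /\<^sub>R t)))"

lemma dominated_le_support:
  assumes "dominated c v" "0 < c" "maximizer c (y - x) p"
  shows "v y - v x \<le> p \<bullet> (y - x)"
proof (cases "y = x")
  case False
  then obtain t where t: "0 < t" "t * (c + L ((y - x) /\<^sub>R t)) \<le> p \<bullet> (y - x)"
    using multiplier_time[OF assms(3,2)] by auto
  have "v y - v x \<le> t * (c + L ((y - x) /\<^sub>R t))"
    using assms(1) t(1) unfolding dominated_def by blast
  then show ?thesis
    using t(2) by linarith
qed auto

text \<open>
  The reflection exchanges the optimal points for the two Lax--Oleinik operators at the origin, so
  that each estimate below has to be proved for only one of them.
\<close>

lemma dominated_reflect: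
  assumes "dominated c v"
  shows "dominated c (\<lambda>x. - v (- x))"
  unfolding dominated_def
proof (intro allI impI)
  fix x y :: 'a and t :: real
  assume "0 < t"
  then have "v (- x) - v (- y) \<le> t * (c + L ((- x - (- y)) /\<^sub>R t))"
    using assms unfolding dominated_def by blast
  then show "- v (- y) - - v (- x) \<le> t * (c + L ((y - x) /\<^sub>R t))"
    by simp
qed

text \<open>
  A bound on \<open>T_up\<close> bounds every competitor in the supremum only if the supremum is finite; this is
  where the growth of \<open>L\<close> has to beat the Lipschitz constant of \<open>u\<close>.
\<close>

lemma dominated_T_up:
  assumes lip: "C-lipschitz_on UNIV u"
    and S: "\<And>x t. 0 < t \<Longrightarrow> S_plus H t u x \<le> c"
  shows "dominated c u"
  unfolding dominated_def
proof (intro allI impI)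
  fix x y :: 'a and t :: real
  assume t: "0 < t"
  obtain M where M: "\<And>q. C * norm q - M \<le> L q"
    using conjugate_growth[of C] lipschitz_on_nonneg[OF lip] by blast
  have "u z - t * L ((z - x) /\<^sub>R t) \<le> u x + t * M" for z
  proof -
    have "u z - u x \<le> C * norm (z - x)"
      using lipschitz_onD[OF lip, of z x] by (simp add: dist_norm)
    moreover have "t * (C * norm ((z - x) /\<^sub>R t) - M) \<le> t * L ((z - x) /\<^sub>R t)"
      using t by (intro mult_left_mono M) auto
    moreover have "t * (C * norm ((z - x) /\<^sub>R t) - M) = C * norm (z - x) - t * M"
      using t by (simp add: right_diff_distrib)
    ultimately show ?thesis
      by linarith
  qed
  then have "bdd_above (range (\<lambda>z. u z - t * L ((z - x) /\<^sub>R t)))"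
    by (auto simp: bdd_above_def)
  then have "u y - t * L ((y - x) /\<^sub>R t) \<le> T_up H t u x"
    unfolding T_up_def by (intro cSUP_upper) auto
  moreover have "T_up H t u x - u x \<le> t * c"
    using S[OF t, of x] t by (simp add: S_plus_def pos_divide_le_eq mult.commute)
  ultimately show "u y - u x \<le> t * (c + L ((y - x) /\<^sub>R t))"
    by (simp add: algebra_simps)
qed

text \<open>
  The maximizers at small positive levels accumulate only in the zero set of \<open>H\<close>, which is convex
  and therefore reduced to the origin. Hence the increments of \<open>v\<close> have no room.
\<close>

lemma dominated_zero_const:
  assumes dom: "dominated 0 v" and seg: "\<not> (\<exists>S. line_segment S \<and> S \<subseteq> H -` {0})"
  shows "v y \<le> v x"
proof -
  \<comment> \<open>The multiplier argument needs a positive level, so \<open>v\<close> is compared at the levels \<open>1 / (n + 1)\<close>.\<close>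
  define c :: "nat \<Rightarrow> real" where "c n = inverse (real (Suc n))" for n
  have c: "0 < c n" "c n \<le> 1" for n
    by (auto simp: c_def field_simps)
  have "\<forall>n. \<exists>p. maximizer (c n) (y - x) p"
    by (intro allI) (meson maximizer_exists c(1) less_imp_le)
  then obtain p where p: "\<And>n. maximizer (c n) (y - x) (p n)"
    by metis
  have le: "v y - v x \<le> p n \<bullet> (y - x)" for n
  proof (rule dominated_le_support[OF _ c(1) p])
    show "dominated (c n) v"
      unfolding dominated_def
    proof (intro allI impI)
      fix a b :: 'a and t :: real
      assume t: "0 < t"
      have "v b - v a \<le> t * (0 + L ((b - a) /\<^sub>R t))"
        using dom t unfolding dominated_def by blast
      also have "\<dots> \<le> t * (c n + L ((b - a) /\<^sub>R t))"
        using t c(1)[of n] by (intro mult_left_mono) auto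
      finally show "v b - v a \<le> t * (c n + L ((b - a) /\<^sub>R t))" .
    qed
  qed
  have Hp: "H (p n) \<le> c n" for n
    using p by (simp add: maximizer_def)
  obtain l r where r: "strict_mono r" and l: "(p \<circ> r) \<longlonglongrightarrow> l"
    using sublevel_subsequence[of p 1, OF order_trans[OF Hp c(2)]] by blast
  have lim_H: "(\<lambda>n. H ((p \<circ> r) n)) \<longlonglongrightarrow> H l"
    by (rule continuous_on_tendsto_compose[OF cont l]) auto
  have "c \<longlonglongrightarrow> 0"
    unfolding c_def by (rule LIMSEQ_inverse_real_of_nat)
  then have lim_c: "(c \<circ> r) \<longlonglongrightarrow> 0"
    using r by (rule LIMSEQ_subseq_LIMSEQ)
  have "H ((p \<circ> r) n) \<le> (c \<circ> r) n" for n
    using Hp[of "r n"] by simp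
  then have "H l \<le> 0"
    by (intro LIMSEQ_le[OF lim_H lim_c]) blast
  have "l = 0"
  proof (rule ccontr)
    assume "l \<noteq> 0"
    then have "0 \<noteq> l"
      by simp
    then have "line_segment (closed_segment 0 l)"
      unfolding line_segment_def by blast
    moreover have "H z = 0" if z: "z \<in> closed_segment 0 l" for z
    proof -
      obtain s where s: "0 \<le> s" "s \<le> 1" "z = (1 - s) *\<^sub>R 0 + s *\<^sub>R l"
        using z unfolding in_segment by blast
      have "H z \<le> (1 - s) * H 0 + s * H l"
        unfolding s(3) using s by (intro convex_onD[OF conv]) auto
      also have "\<dots> \<le> 0"
        using mult_nonneg_nonpos[OF s(1) \<open>H l \<le> 0\<close>] H_zero by simp
      finally show ?thesis
        using H_nonneg[of z] by linarith
    qed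
    ultimately show False
      using seg by blast
  qed
  have lim: "(\<lambda>n. (p \<circ> r) n \<bullet> (y - x)) \<longlonglongrightarrow> l \<bullet> (y - x)"
    using l by (intro tendsto_intros)
  have "v y - v x \<le> (p \<circ> r) n \<bullet> (y - x)" for n
    using le[of "r n"] by simp
  then have "v y - v x \<le> l \<bullet> (y - x)"
    by (intro LIMSEQ_le_const[OF lim]) blast
  then show ?thesis
    using \<open>l = 0\<close> by simp
qed

section \<open>Rigidity along almost optimal points\<close>

text \<open>
  Growth of \<open>L\<close> with a slope one above the Lipschitz constant makes it unprofitable to move
  faster than some fixed speed.
\<close>

lemma optimal_bounded:
  assumes lip: "C-lipschitz_on UNIV v" and "0 \<le> c"
  shows "\<exists>B. \<forall>t y e. 0 < t \<longrightarrow> e \<le> t \<longrightarrow> t * (c + L (y /\<^sub>R t)) - e \<le> v y - v 0 \<longrightarrow> norm (y /\<^sub>R t) \<le> B"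
proof -
  obtain M where M: "\<And>q. (C + 1) * norm q - M \<le> L q"
    using conjugate_growth[of "C + 1"] lipschitz_on_nonneg[OF lip] by force
  have "norm (y /\<^sub>R t) \<le> M + 1"
    if t: "0 < t" and e: "e \<le> t" and opt: "t * (c + L (y /\<^sub>R t)) - e \<le> v y - v 0" for t y e
  proof -
    define q where "q = y /\<^sub>R t"
    have y: "norm y = t * norm q"
      using t by (simp add: q_def)
    have "v y - v 0 \<le> C * (t * norm q)"
      using lipschitz_onD[OF lip, of y 0] y by (simp add: dist_norm)
    moreover have "t * ((C + 1) * norm q - M) \<le> t * (c + L q)"
      using t M[of q] \<open>0 \<le> c\<close> by (intro mult_left_mono) auto
    ultimately have "t * ((C + 1) * norm q - M) - t \<le> C * (t * norm q)"
      using opt e unfolding q_def by linarith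
    then have "t * norm q \<le> t * (M + 1)"
      by (simp add: algebra_simps)
    then show ?thesis
      using t by (simp add: q_def)
  qed
  then show ?thesis
    by blast
qed

text \<open>
  Write \<open>\<sigma>\<close> for the support function of the sublevel set. As \<open>v (Y n) - v 0\<close> is almost
  \<open>\<sigma> (Y n)\<close> and \<open>v (Y n) - v x \<le> \<sigma> (Y n - x)\<close>, the increment \<open>v x - v 0\<close> is almost at least
  \<open>\<sigma> (Y n) - \<sigma> (Y n - x)\<close>. A maximizer \<open>P n\<close> for \<open>Y n - x\<close> bounds this difference below by
  \<open>P n \<bullet> x\<close>. Seen at scale \<open>t n\<close>, the shift by \<open>x\<close> disappears, so \<open>P n\<close> tends to the unique
  maximizer in the limit direction.
\<close>

lemma optimal_slope_le:
  assumes dom: "dominated c v" and "0 < c"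
    and t: "\<And>n. 0 < t n" "(\<lambda>n. inverse (t n)) \<longlonglongrightarrow> 0" and e: "e \<longlonglongrightarrow> 0"
    and opt: "\<And>n. t n * (c + L (Y n /\<^sub>R t n)) - e n \<le> v (Y n) - v 0"
    and q: "(\<lambda>n. Y n /\<^sub>R t n) \<longlonglongrightarrow> q"
    and uniq: "\<And>p'. maximizer c q p' \<Longrightarrow> p' = p"
  shows "p \<bullet> x \<le> v x - v 0"
proof -
  have "\<forall>n. \<exists>p. maximizer c (Y n - x) p"
    by (intro allI) (meson maximizer_exists \<open>0 < c\<close> less_imp_le)
  then obtain P where P: "\<And>n. maximizer c (Y n - x) (P n)"
    by metis
  have HP: "H (P n) \<le> c" for n
    using P by (simp add: maximizer_def)
  have slope: "P n \<bullet> x \<le> v x - v 0 + e n" for n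
  proof -
    have "v (Y n) - v x \<le> P n \<bullet> (Y n - x)"
      by (rule dominated_le_support[OF dom \<open>0 < c\<close> P])
    moreover have "P n \<bullet> Y n \<le> t n * (c + L (Y n /\<^sub>R t n))"
      by (rule support_le_action[OF t(1) HP])
    ultimately show ?thesis
      using opt[of n] by (simp add: inner_diff_right)
  qed
  obtain l r where r: "strict_mono r" and l: "(P \<circ> r) \<longlonglongrightarrow> l"
    using sublevel_subsequence[of P, OF HP] by blast
  have "maximizer c (q - 0 *\<^sub>R x) l"
  proof (rule maximizer_limit[OF l])
    have "(\<lambda>n. Y n /\<^sub>R t n - inverse (t n) *\<^sub>R x) \<longlonglongrightarrow> q - 0 *\<^sub>R x"
      using q t(2) by (intro tendsto_intros)
    then show "((\<lambda>n. Y n /\<^sub>R t n - inverse (t n) *\<^sub>R x) \<circ> r) \<longlonglongrightarrow> q - 0 *\<^sub>R x"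
      using r by (rule LIMSEQ_subseq_LIMSEQ)
    show "(\<lambda>n. 0::real) \<longlonglongrightarrow> 0"
      by simp
    show "H ((P \<circ> r) n) \<le> c" for n
      using HP by simp
    fix n z
    assume "H z \<le> c"
    have "maximizer c (inverse (t (r n)) *\<^sub>R (Y (r n) - x)) (P (r n))"
      using P t(1) by (intro maximizer_scale) auto
    then show "z \<bullet> ((\<lambda>n. Y n /\<^sub>R t n - inverse (t n) *\<^sub>R x) \<circ> r) n
        \<le> (P \<circ> r) n \<bullet> ((\<lambda>n. Y n /\<^sub>R t n - inverse (t n) *\<^sub>R x) \<circ> r) n + 0"
      using \<open>H z \<le> c\<close> by (simp add: maximizer_def scaleR_diff_right)
  qed
  then have "l = p"
    using uniq by simp
  have lim_l: "(\<lambda>n. (P \<circ> r) n \<bullet> x) \<longlonglongrightarrow> l \<bullet> x"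
    using l by (intro tendsto_intros)
  have lim_v: "(\<lambda>n. v x - v 0 + (e \<circ> r) n) \<longlonglongrightarrow> v x - v 0 + 0"
    using LIMSEQ_subseq_LIMSEQ[OF e r] by (intro tendsto_intros)
  have "(P \<circ> r) n \<bullet> x \<le> v x - v 0 + (e \<circ> r) n" for n
    using slope by simp
  then have "l \<bullet> x \<le> v x - v 0 + 0"
    by (intro LIMSEQ_le[OF lim_l lim_v]) blast
  then show ?thesis
    using \<open>l = p\<close> by simp
qed

text \<open>
  The increment of \<open>v\<close> from \<open>- W\<close> to \<open>Y\<close> is almost the sum of the support function at \<open>Y\<close> and at
  \<open>W\<close>, yet at most its value at \<open>Y + W\<close>. A loss of \<open>P\<close> in one of the two directions could not be
  made up in the other.
\<close>

lemma common_maximizer: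
  assumes dom: "dominated c v" and "0 < c" "0 < t"
    and Y: "t * (c + L (Y /\<^sub>R t)) - e \<le> v Y - v 0"
    and W: "t * (c + L (W /\<^sub>R t)) - e \<le> v 0 - v (- W)"
    and P: "maximizer c (Y + W) P" and r: "H r \<le> c"
  shows "r \<bullet> Y \<le> P \<bullet> Y + 2 * e" "r \<bullet> W \<le> P \<bullet> W + 2 * e"
proof -
  have "maximizer c (Y - (- W)) P"
    using P by simp
  from dominated_le_support[OF dom \<open>0 < c\<close> this]
  have "v Y - v (- W) \<le> P \<bullet> Y + P \<bullet> W"
    by (simp add: inner_add_right)
  moreover have "P \<bullet> Y \<le> t * (c + L (Y /\<^sub>R t))" "P \<bullet> W \<le> t * (c + L (W /\<^sub>R t))"
    "r \<bullet> Y \<le> t * (c + L (Y /\<^sub>R t))" "r \<bullet> W \<le> t * (c + L (W /\<^sub>R t))"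
    using P r \<open>0 < t\<close> by (auto intro!: support_le_action simp: maximizer_def)
  ultimately show "r \<bullet> Y \<le> P \<bullet> Y + 2 * e" "r \<bullet> W \<le> P \<bullet> W + 2 * e"
    using Y W by linarith+
qed

text \<open>
  One subsequence has to serve both families of almost optimal points: the direction \<open>q\<close> bounds
  \<open>v x - v 0\<close> from below and \<open>w\<close> bounds it from above, and the two bounds agree because the limit
  of the common maximizers is the maximizer for both.
\<close>

lemma linear_of_almost_optimal:
  assumes dom: "dominated c v" and "0 < c" and lip: "C-lipschitz_on UNIV v"
    and seg: "\<not> (\<exists>S. line_segment S \<and> S \<subseteq> H -` {c})"
    and Y_ex: "\<And>t e. \<lbrakk>0 < t; 0 < e\<rbrakk> \<Longrightarrow> \<exists>y. t * (c + L (y /\<^sub>R t)) - e \<le> v y - v 0"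
    and W_ex: "\<And>t e. \<lbrakk>0 < t; 0 < e\<rbrakk> \<Longrightarrow> \<exists>y. t * (c + L (y /\<^sub>R t)) - e \<le> v 0 - v (- y)"
  shows "\<exists>p. H p = c \<and> (\<forall>x. v x = v 0 + p \<bullet> x)"
proof -
  define t :: "nat \<Rightarrow> real" where "t n = real (Suc n)" for n
  \<comment> \<open>The tolerance has to vanish in the limit and stay below the time.\<close>
  define e where "e n = inverse (t n)" for n
  have te: "0 < t n" "0 < e n" "1 \<le> t n" "e n \<le> t n" for n
  proof -
    show t1: "0 < t n" "1 \<le> t n"
      by (auto simp: t_def)
    then show "0 < e n"
      by (simp add: e_def)
    have "e n \<le> 1"
      using t1 by (simp add: e_def inverse_le_1_iff)
    then show "e n \<le> t n"
      using t1 by linarith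
  qed
  have e0: "e \<longlonglongrightarrow> 0"
    unfolding e_def t_def by (rule LIMSEQ_inverse_real_of_nat)
  have "\<forall>n. \<exists>y. t n * (c + L (y /\<^sub>R t n)) - e n \<le> v y - v 0"
    using Y_ex te(1,2) by blast
  then obtain Y where Y: "\<And>n. t n * (c + L (Y n /\<^sub>R t n)) - e n \<le> v (Y n) - v 0"
    by metis
  have "\<forall>n. \<exists>y. t n * (c + L (y /\<^sub>R t n)) - e n \<le> v 0 - v (- y)"
    using W_ex te(1,2) by blast
  then obtain W where W: "\<And>n. t n * (c + L (W n /\<^sub>R t n)) - e n \<le> v 0 - v (- W n)"
    by metis
  let ?q = "\<lambda>n. Y n /\<^sub>R t n" and ?w = "\<lambda>n. W n /\<^sub>R t n"
  let ?v' = "\<lambda>x. - v (- x)"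
  have dom': "dominated c ?v'"
    by (rule dominated_reflect[OF dom])
  have W': "t n * (c + L (W n /\<^sub>R t n)) - e n \<le> ?v' (W n) - ?v' 0" for n
    using W[of n] by simp
  have lip': "C-lipschitz_on UNIV ?v'"
  proof (rule lipschitz_onI)
    fix x y :: 'a
    have "dist (- x) (- y) = dist x y"
      by (simp add: dist_norm norm_minus_commute)
    then show "dist (?v' x) (?v' y) \<le> C * dist x y"
      using lipschitz_onD[OF lip, of "- x" "- y"] by (simp add: dist_real_def abs_minus_commute)
  qed (rule lipschitz_on_nonneg[OF lip])
  obtain B1 where B1: "\<And>n. norm (?q n) \<le> B1"
    using optimal_bounded[OF lip less_imp_le[OF \<open>0 < c\<close>]] te(1,4) Y by blast
  obtain B2 where B2: "\<And>n. norm (?w n) \<le> B2"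
    using optimal_bounded[OF lip' less_imp_le[OF \<open>0 < c\<close>]] te(1,4) W' by blast
  have "\<forall>n. \<exists>p. maximizer c (Y n + W n) p"
    by (intro allI) (meson maximizer_exists \<open>0 < c\<close> less_imp_le)
  then obtain P where P: "\<And>n. maximizer c (Y n + W n) (P n)"
    by metis
  have HP: "H (P n) \<le> c" for n
    using P by (simp add: maximizer_def)
  have near: "r \<bullet> ?q n \<le> P n \<bullet> ?q n + 2 * e n" "r \<bullet> ?w n \<le> P n \<bullet> ?w n + 2 * e n"
    if r: "H r \<le> c" for r n
  proof -
    have scale: "r \<bullet> (z /\<^sub>R t n) \<le> P n \<bullet> (z /\<^sub>R t n) + 2 * e n" if "r \<bullet> z \<le> P n \<bullet> z + 2 * e n" for z
    proof -
      have "r \<bullet> z / t n \<le> (P n \<bullet> z + 2 * e n) / t n"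
        using that te(1)[of n] by (simp add: divide_right_mono)
      also have "\<dots> = P n \<bullet> z / t n + 2 * e n / t n"
        by (simp add: add_divide_distrib)
      also have "\<dots> \<le> P n \<bullet> z / t n + 2 * e n"
        using te[of n] by (simp add: divide_le_eq)
      finally show ?thesis
        by (simp add: divide_inverse mult.commute)
    qed
    note common = common_maximizer[OF dom \<open>0 < c\<close> te(1) Y W P r]
    show "r \<bullet> ?q n \<le> P n \<bullet> ?q n + 2 * e n" "r \<bullet> ?w n \<le> P n \<bullet> ?w n + 2 * e n"
      by (rule scale, rule common)+
  qed
  have "bounded (range (\<lambda>n. (?q n, ?w n, P n)))"
  proof -
    obtain B3 where B3: "\<And>n. norm (P n) \<le> B3"
      using compact_imp_bounded[OF compact_sublevel[of c]] HP unfolding bounded_iff by auto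
    have "norm (?q n, ?w n, P n) \<le> B1 + (B2 + B3)" for n
      using norm_Pair_le[of "?q n" "(?w n, P n)"] norm_Pair_le[of "?w n" "P n"] B1[of n] B2[of n] B3[of n]
      by linarith
    then show ?thesis
      unfolding bounded_iff by blast
  qed
  from bounded_imp_convergent_subsequence[OF this] obtain l r
    where r: "strict_mono r" and l: "((\<lambda>n. (?q n, ?w n, P n)) \<circ> r) \<longlonglongrightarrow> l"
    by blast
  obtain q w p where lq: "l = (q, w, p)"
    by (cases l) auto
  have lims: "(\<lambda>n. ?q (r n)) \<longlonglongrightarrow> q" "(\<lambda>n. ?w (r n)) \<longlonglongrightarrow> w" "(\<lambda>n. P (r n)) \<longlonglongrightarrow> p"
    using tendsto_fst[OF l] tendsto_fst[OF tendsto_snd[OF l]] tendsto_snd[OF tendsto_snd[OF l]]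
    by (auto simp: lq o_def)
  have er: "(\<lambda>n. e (r n)) \<longlonglongrightarrow> 0"
    using LIMSEQ_subseq_LIMSEQ[OF e0 r] by (simp add: o_def)
  have er2: "(\<lambda>n. 2 * e (r n)) \<longlonglongrightarrow> 0"
    using tendsto_mult_left[OF er, of 2] by simp
  have maxq: "maximizer c q p" and maxw: "maximizer c w p"
    by (rule maximizer_limit[OF lims(3) lims(1) er2 HP near(1)]
        maximizer_limit[OF lims(3) lims(2) er2 HP near(2)]; assumption)+
  \<comment> \<open>Since \<open>L \<ge> 0\<close>, an almost optimal increment over time \<open>t\<close> is almost at least \<open>c * t\<close>; so the
    limit direction has \<open>p \<bullet> z \<ge> c > 0\<close>.\<close>
  have nonzero: "z \<noteq> 0"
    if f: "dominated c f" and Z: "\<And>n. t n * (c + L (Z n /\<^sub>R t n)) - e n \<le> f (Z n) - f 0"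
      and z: "(\<lambda>n. Z (r n) /\<^sub>R t (r n)) \<longlonglongrightarrow> z"
      and nr: "\<And>r n. H r \<le> c \<Longrightarrow> r \<bullet> (Z n /\<^sub>R t n) \<le> P n \<bullet> (Z n /\<^sub>R t n) + 2 * e n" for f Z z
  proof -
    have low: "c \<le> P n \<bullet> (Z n /\<^sub>R t n) + 3 * e n" for n
    proof -
      obtain s where s: "maximizer c (Z n) s"
        using maximizer_exists \<open>0 < c\<close> by (meson less_imp_le)
      have "f (Z n) - f 0 \<le> s \<bullet> Z n"
        using dominated_le_support[OF f \<open>0 < c\<close>, of "Z n" 0 s] s by simp
      moreover have "t n * c \<le> t n * (c + L (Z n /\<^sub>R t n))"
        using te(1)[of n] conjugate_nonneg by (intro mult_left_mono) auto
      ultimately have "t n * c - e n \<le> s \<bullet> Z n"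
        using Z[of n] by linarith
      then have "(t n * c - e n) / t n \<le> (s \<bullet> Z n) / t n"
        using te(1)[of n] by (intro divide_right_mono) auto
      moreover have "(t n * c - e n) / t n = c - e n / t n"
        using te(1)[of n] by (simp add: diff_divide_distrib)
      moreover have "(s \<bullet> Z n) / t n = s \<bullet> (Z n /\<^sub>R t n)"
        by (simp add: divide_inverse_commute)
      ultimately have "c - e n / t n \<le> s \<bullet> (Z n /\<^sub>R t n)"
        by linarith
      moreover have "e n / t n \<le> e n"
        using te[of n] by (simp add: divide_le_eq)
      ultimately show ?thesis
        using nr[of s n] s by (simp add: maximizer_def)
    qed
    have lim: "(\<lambda>n. P (r n) \<bullet> (Z (r n) /\<^sub>R t (r n)) + 3 * e (r n)) \<longlonglongrightarrow> p \<bullet> z + 3 * 0"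
      using lims(3) z er by (intro tendsto_intros)
    have "c \<le> p \<bullet> z + 3 * 0"
      using low by (intro LIMSEQ_le_const[OF lim]) blast
    then show ?thesis
      using \<open>0 < c\<close> by auto
  qed
  have q0: "q \<noteq> 0"
    by (rule nonzero[OF dom Y lims(1) near(1)])
  have w0: "w \<noteq> 0"
    by (rule nonzero[OF dom' W' lims(2) near(2)])
  have tr: "\<And>n. 0 < t (r n)" "(\<lambda>n. inverse (t (r n))) \<longlonglongrightarrow> 0"
    using te(1) er by (auto simp: e_def)
  have "p \<bullet> x \<le> v x - v 0" for x
    using Y lims(1) maximizer_unique[OF seg q0 _ maxq]
    by (intro optimal_slope_le[OF dom \<open>0 < c\<close> tr er]) auto
  moreover have "p \<bullet> (- x) \<le> ?v' (- x) - ?v' 0" for x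
    using W' lims(2) maximizer_unique[OF seg w0 _ maxw]
    by (intro optimal_slope_le[OF dom' \<open>0 < c\<close> tr er]) auto
  ultimately have "v x = v 0 + p \<bullet> x" for x
    by (smt (verit) inner_minus_right minus_minus minus_zero)
  then show ?thesis
    using maximizer_on_level[OF maxq q0] by blast
qed

end

section \<open>Functions with constant slopes at the origin\<close>

theorem theorem5p1:
  fixes H u :: "real ^ 'n \<Rightarrow> real" and k :: real
  assumes "CARD('n) \<ge> 2"
    and "continuous_on UNIV H"
    and "convex_on UNIV H"
    and "superlinear H"
    and "H 0 = 0" and "\<forall>p. H 0 \<le> H p"
    and "\<forall>c::real. \<not> (\<exists>S. line_segment S \<and> S \<subseteq> H -` {c})"
    and "0 \<le> k"
    and "\<exists>C. C-lipschitz_on UNIV u"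
    and "\<forall>t>0. S_plus H t u 0 = k \<and> - S_minus H t u 0 = k"
    and "\<forall>x. \<forall>t>0. max (S_plus H t u x) (- S_minus H t u x) \<le> k"
  shows "\<exists>p0. H p0 = k \<and> (\<forall>x. u x = u 0 + p0 \<bullet> x)"
proof -
  interpret convex_hamiltonian H
    using assms(2-6) by unfold_locales auto
  obtain C where lip: "C-lipschitz_on UNIV u"
    using assms(9) by blast
  have dom: "dominated k u"
    using assms(11) by (intro dominated_T_up[OF lip]) auto
  show ?thesis
  proof (cases "k = 0")
    case True
    then have "u x \<le> u y" for x y
      using dominated_zero_const[of u x y] dom assms(7) by blast
    then have "u x = u 0 + 0 \<bullet> x" for x
      by (simp add: antisym)
    then show ?thesis
      using True H_zero by blast
  next
    case False
    then have "0 < k"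
      using assms(8) by simp
    then show ?thesis
    proof (rule linear_of_almost_optimal[OF dom _ lip])
      show "\<not> (\<exists>S. line_segment S \<and> S \<subseteq> H -` {k})"
        using assms(7) by blast
    next
      fix t e :: real
      assume t: "0 < t" and e: "0 < e"
      have "T_up H t u 0 - u 0 = t * k"
        using assms(10) t by (auto simp: S_plus_def field_simps)
      then have "u 0 + t * k - e < (SUP y. u y - t * L ((y - 0) /\<^sub>R t))"
        using e unfolding T_up_def by linarith
      then obtain y where "u 0 + t * k - e < u y - t * L ((y - 0) /\<^sub>R t)"
        by (rule less_cSupE) auto
      then have "t * (k + L (y /\<^sub>R t)) - e \<le> u y - u 0"
        by (simp add: algebra_simps)
      then show "\<exists>y. t * (k + L (y /\<^sub>R t)) - e \<le> u y - u 0"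
        by blast
    next
      fix t e :: real
      assume t: "0 < t" and e: "0 < e"
      have "u 0 - T_down H t u 0 = t * k"
        using assms(10) t by (auto simp: S_minus_def field_simps)
      then have "(INF y. u y + t * L ((0 - y) /\<^sub>R t)) < u 0 - t * k + e"
        using e unfolding T_down_def by linarith
      then obtain y where "u y + t * L ((0 - y) /\<^sub>R t) < u 0 - t * k + e"
        using cInf_lessD by blast
      then have "t * (k + L ((- y) /\<^sub>R t)) - e \<le> u 0 - u (- (- y))"
        by (simp add: algebra_simps)
      then show "\<exists>y. t * (k + L (y /\<^sub>R t)) - e \<le> u 0 - u (- y)"
        by blast
    qed
  qed
qed

end
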